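(* For every convergence space $(X,L)$: (i) $\mathsf S_{\mathrm{fin}}(\mathcal C_L,\mathcal C_L)$ holds if and only if Alice has no winning strategy in $\mathsf G_{\mathrm{fin}}(\mathcal C_L,\mathcal C_L)$; (ii) $\mathsf S_1(\mathcal C_L,\mathcal C_L)$ holds if and only if Alice has no winning strategy in $\mathsf G_1(\mathcal C_L,\mathcal C_L)$.
   Context: All filters are proper. $\operatorname{Fil}(X)$ is the set of filters on $X$, and $\dot x=\{A\subseteq X:x\in A\}$. A convergence on $X$ is a function $L:\operatorname{Fil}(X)\to\mathcal P(X)$ such that $x\in L(\dot x)$ for every $x\in X$, and $L(\mathcal F)\subseteq L(\mathcal G)$ whenever $\mathcal F\subseteq\mathcal G$; then $(X,L)$ is a convergence space. A family $\mathcal U\subseteq\mathcal P(X)$ is an $L$-cover if $\mathcal U\cap\mathcal F\neq\varnothing$ for every $\mathcal F\in\operatorname{Fil}(X)$ with $L(\mathcal F)\neq\varnothing$; $\mathcal C_L$ is the family of all $L$-covers. For collections $\mathcal A,\mathcal B$ of families of sets: $\mathsf S_1(\mathcal A,\mathcal B)$ asserts that for every sequence $\langle\mathcal U_n:n<\omega\rangle$ in $\mathcal A$ there are $U_n\in\mathcal U_n$ with $\{U_n:n<\omega\}\in\mathcal B$; $\mathsf S_{\mathrm{fin}}(\mathcal A,\mathcal B)$ asserts that there are finite $\mathcal V_n\subseteq\mathcal U_n$ with $\bigcup_{n<\omega}\mathcal V_n\in\mathcal B$. In the game $\mathsf G_1(\mathcal A,\mathcal B)$ (resp. $\mathsf G_{\mathrm{fin}}(\mathcal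 A,\mathcal B)$), in each inning $n<\omega$ Alice chooses $\mathcal U_n\in\mathcal A$ and then Bob chooses a member (resp. a finite subfamily) of $\mathcal U_n$; Bob wins if the family of all sets he selected belongs to $\mathcal B$, otherwise Alice wins. *)

theory Defs
  imports Complex_Main
begin

text \<open>
  A proper filter on the carrier \<open>X\<close> is a library filter \<open>F\<close> with \<open>F \<noteq> bot\<close> and
  \<open>F \<le> principal X\<close>; its members are the \<open>A \<subseteq> X\<close> with \<open>eventually (\<lambda>x. x \<in> A) F\<close>.
  The library order on filters is reverse inclusion of the families of members, and the
  principal ultrafilter at \<open>x\<close> is \<open>principal {x}\<close>. The lemmas below confirm that this is the
  usual notion of a filter as a family of subsets of \<open>X\<close>.
\<close>

definition Fil :: "'a set \<Rightarrow> 'a filter set" where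
  "Fil X = {F. F \<noteq> bot \<and> F \<le> principal X}"

definition members :: "'a set \<Rightarrow> 'a filter \<Rightarrow> 'a set set" where
  "members X F = {A. A \<subseteq> X \<and> eventually (\<lambda>x. x \<in> A) F}"

lemma eventually_iff_members:
  assumes "F \<in> Fil X"
  shows "eventually P F \<longleftrightarrow> {x \<in> X. P x} \<in> members X F"
proof -
  have X: "eventually (\<lambda>x. x \<in> X) F"
    using assms by (simp add: Fil_def le_principal)
  show ?thesis
    unfolding members_def using eventually_conj_iff[of "\<lambda>x. x \<in> X" P F] X by auto
qed

lemma members_subset_iff:
  assumes "F \<in> Fil X" "G \<in> Fil X"
  shows "members X F \<subseteq> members X G \<longleftrightarrow> G \<le> F"
proof
  assume "members X F \<subseteq> members X G"
  then show "G \<le> F"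
    using assms by (auto simp: le_filter_def eventually_iff_members)
next
  assume "G \<le> F"
  then show "members X F \<subseteq> members X G"
    by (auto simp: le_filter_def members_def)
qed

lemma members_principal:
  assumes "x \<in> X"
  shows "principal {x} \<in> Fil X" "members X (principal {x}) = {A. A \<subseteq> X \<and> x \<in> A}"
  using assms by (auto simp: Fil_def members_def eventually_principal principal_eq_bot_iff)

lemma bij_betw_members:
  "bij_betw (members X) (Fil X)
     {\<F>. \<F> \<subseteq> Pow X \<and> X \<in> \<F> \<and> {} \<notin> \<F> \<and>
        (\<forall>A\<in>\<F>. \<forall>B\<in>\<F>. A \<inter> B \<in> \<F>) \<and> (\<forall>A\<in>\<F>. \<forall>B. A \<subseteq> B \<and> B \<subseteq> X \<longrightarrow> B \<in> \<F>)}"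
  (is "bij_betw _ _ ?R")
  unfolding bij_betw_def
proof (intro conjI equalityI subsetI)
  show "inj_on (members X) (Fil X)"
    by (rule inj_onI) (metis antisym members_subset_iff order_refl)
next
  fix \<F> assume "\<F> \<in> members X ` Fil X"
  then obtain F where F: "F \<in> Fil X" "\<F> = members X F"
    by auto
  have "eventually (\<lambda>x. x \<in> X) F" "F \<noteq> bot"
    using F(1) by (auto simp: Fil_def le_principal)
  then show "\<F> \<in> ?R"
    unfolding F(2) members_def
    by (auto simp: eventually_False eventually_conj_iff elim: eventually_mono)
next
  fix \<F> assume R: "\<F> \<in> ?R"
  define F where "F = Abs_filter (\<lambda>P. {x \<in> X. P x} \<in> \<F>)"
  have ev: "eventually P F \<longleftrightarrow> {x \<in> X. P x} \<in> \<F>" for P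
    unfolding F_def
  proof (rule eventually_Abs_filter, rule is_filter.intro)
    show "{x \<in> X. True} \<in> \<F>"
      using R by simp
  next
    fix P Q assume "{x \<in> X. P x} \<in> \<F>" "{x \<in> X. Q x} \<in> \<F>"
    then have "{x \<in> X. P x} \<inter> {x \<in> X. Q x} \<in> \<F>"
      using R by blast
    moreover have "{x \<in> X. P x} \<inter> {x \<in> X. Q x} = {x \<in> X. P x \<and> Q x}"
      by auto
    ultimately show "{x \<in> X. P x \<and> Q x} \<in> \<F>"
      by simp
  next
    fix P Q :: "'a \<Rightarrow> bool" assume "\<forall>x. P x \<longrightarrow> Q x" "{x \<in> X. P x} \<in> \<F>"
    moreover from this have "{x \<in> X. P x} \<subseteq> {x \<in> X. Q x}"
      by auto
    ultimately show "{x \<in> X. Q x} \<in> \<F>"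
      using R by blast
  qed
  have "F \<in> Fil X"
    using R ev[of "\<lambda>x. x \<in> X"] ev[of "\<lambda>x. False"]
    by (auto simp: Fil_def le_principal)
  moreover have "members X F = \<F>"
  proof -
    have "{x \<in> X. x \<in> A} = A" if "A \<subseteq> X" for A
      using that by auto
    then show ?thesis
      using R by (auto simp: members_def ev)
  qed
  ultimately show "\<F> \<in> members X ` Fil X"
    by blast
qed

text \<open>Only the values of \<open>L\<close> on \<open>Fil X\<close> are relevant.\<close>

definition convergence_space :: "'a set \<Rightarrow> ('a filter \<Rightarrow> 'a set) \<Rightarrow> bool" where
  "convergence_space X L \<longleftrightarrow>
     (\<forall>F\<in>Fil X. L F \<subseteq> X) \<and>
     (\<forall>x\<in>X. x \<in> L (principal {x})) \<and>
     (\<forall>F\<in>Fil X. \<forall>G\<in>Fil X. members X F \<subseteq> members X G \<longrightarrow> L F \<subseteq> L G)"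

definition covers :: "'a set \<Rightarrow> ('a filter \<Rightarrow> 'a set) \<Rightarrow> 'a set set set" where
  "covers X L = {\<U>. \<U> \<subseteq> Pow X \<and> (\<forall>F\<in>Fil X. L F \<noteq> {} \<longrightarrow> \<U> \<inter> members X F \<noteq> {})}"

definition S_1 :: "'a set set set \<Rightarrow> 'a set set set \<Rightarrow> bool" where
  "S_1 \<A> \<B> \<longleftrightarrow>
     (\<forall>\<U> :: nat \<Rightarrow> 'a set set. (\<forall>n. \<U> n \<in> \<A>) \<longrightarrow> (\<exists>U. (\<forall>n. U n \<in> \<U> n) \<and> range U \<in> \<B>))"

definition S_fin :: "'a set set set \<Rightarrow> 'a set set set \<Rightarrow> bool" where
  "S_fin \<A> \<B> \<longleftrightarrow>
     (\<forall>\<U> :: nat \<Rightarrow> 'a set set. (\<forall>n. \<U> n \<in> \<A>) \<longrightarrow>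
        (\<exists>\<V>. (\<forall>n. finite (\<V> n) \<and> \<V> n \<subseteq> \<U> n) \<and> (\<Union>n. \<V> n) \<in> \<B>))"

text \<open>
  A strategy \<open>\<sigma>\<close> for Alice maps the finite list of Bob's previous choices to her next move; its
  values at lists that do not arise from a legal play are irrelevant. It is winning if Alice wins
  every play in which she follows it. In the single-selection game, a play in which Bob
  cannot answer because Alice has chosen the empty family is not won by Bob. This happens
  only for \<open>X = {}\<close>, where the empty family is a cover.
\<close>

definition Alice_wins_G_1 :: "'a set set set \<Rightarrow> 'a set set set \<Rightarrow> bool" where
  "Alice_wins_G_1 \<A> \<B> \<longleftrightarrow>
     (\<exists>\<sigma> :: 'a set list \<Rightarrow> 'a set set. (\<forall>s. \<sigma> s \<in> \<A>) \<and>
        (\<forall>U :: nat \<Rightarrow> 'a set. (\<forall>n. U n \<in> \<sigma> (map U [0..<n])) \<longrightarrow> range U \<notin> \<B>))"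

definition Alice_wins_G_fin :: "'a set set set \<Rightarrow> 'a set set set \<Rightarrow> bool" where
  "Alice_wins_G_fin \<A> \<B> \<longleftrightarrow>
     (\<exists>\<sigma> :: 'a set set list \<Rightarrow> 'a set set. (\<forall>s. \<sigma> s \<in> \<A>) \<and>
        (\<forall>\<V> :: nat \<Rightarrow> 'a set set. (\<forall>n. finite (\<V> n) \<and> \<V> n \<subseteq> \<sigma> (map \<V> [0..<n])) \<longrightarrow>
           (\<Union>n. \<V> n) \<notin> \<B>))"

end

theory Submission
  imports Defs "HOL-Analysis.Abstract_Topology"
begin

text \<open>
  The convergent filters form a topological space with base the sets of all convergent filters
  containing a given \<open>A \<subseteq> X\<close>, and the \<open>L\<close>-covers are exactly its covers by basic open sets. So the
  claim reduces to the theorems of Hurewicz and Pawlikowski on the Menger and Rothberger games on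
  arbitrary topological spaces.

  For Hurewicz, Alice plays increasing covers indexed by \<open>nat\<close>. Starting from a given position,
  every point has for each \<open>n\<close> a neighbourhood that is covered during the next \<open>n\<close> innings for all
  but finitely many choices of Bob. So the Menger property yields finitely many forbidden choices
  for each position and each \<open>n\<close>. If Bob avoids them, he covers every point infinitely often.
  For Pawlikowski, Bob first plays a Menger game against all the positions of the Rothberger game
  that are still possible, and the Rothberger property then selects one move for each position.
\<close>

section \<open>Open covers, and selection principles from games\<close>

definition open_covers :: "'z topology \<Rightarrow> 'z set set set" where
  "open_covers T = {\<U>. (\<forall>U\<in>\<U>. openin T U) \<and> \<Union>\<U> = topspace T}"

lemma open_coversI:
  assumes "\<And>U. U \<in> \<U> \<Longrightarrow> openin T U" "\<And>x. x \<in> topspace T \<Longrightarrow> \<exists>U\<in>\<U>. x \<in> U"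
  shows "\<U> \<in> open_covers T"
  using assms openin_subset unfolding open_covers_def by blast

lemma openin_open_covers:
  assumes "\<U> \<in> open_covers T" "U \<in> \<U>"
  shows "openin T U"
  using assms by (simp add: open_covers_def)

lemma S_1_imp_S_fin:
  assumes "S_1 \<A> \<B>"
  shows "S_fin \<A> \<B>"
  unfolding S_fin_def
proof (intro allI impI)
  fix \<U> :: "nat \<Rightarrow> 'a set set"
  assume "\<forall>n. \<U> n \<in> \<A>"
  then obtain U where U: "\<forall>n. U n \<in> \<U> n" "range U \<in> \<B>"
    using assms unfolding S_1_def by blast
  have "(\<Union>n. {U n}) = range U"
    by auto
  with U show "\<exists>\<V>. (\<forall>n. finite (\<V> n) \<and> \<V> n \<subseteq> \<U> n) \<and> (\<Union>n. \<V> n) \<in> \<B>"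
    by (intro exI[of _ "\<lambda>n. {U n}"]) auto
qed

text \<open>A sequence of families is a strategy for Alice that looks only at the number of the
  inning. A play in which Bob defeats it is the desired selection.\<close>

lemma S_1_if_not_Alice_wins:
  assumes "\<not> Alice_wins_G_1 \<A> \<B>"
  shows "S_1 \<A> \<B>"
  unfolding S_1_def
proof (intro allI impI)
  fix \<U> :: "nat \<Rightarrow> 'a set set"
  assume "\<forall>n. \<U> n \<in> \<A>"
  then have "\<forall>s :: 'a set list. \<U> (length s) \<in> \<A>"
    by blast
  then obtain U where "\<forall>n. U n \<in> \<U> (length (map U [0..<n]))" "range U \<in> \<B>"
    using assms[unfolded Alice_wins_G_1_def not_ex, rule_format, of "\<lambda>s. \<U> (length s)"] by blast
  then show "\<exists>U. (\<forall>n. U n \<in> \<U> n) \<and> range U \<in> \<B>"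
    by auto
qed

lemma S_fin_if_not_Alice_wins:
  assumes "\<not> Alice_wins_G_fin \<A> \<B>"
  shows "S_fin \<A> \<B>"
  unfolding S_fin_def
proof (intro allI impI)
  fix \<U> :: "nat \<Rightarrow> 'a set set"
  assume "\<forall>n. \<U> n \<in> \<A>"
  then have "\<forall>s :: 'a set set list. \<U> (length s) \<in> \<A>"
    by blast
  then obtain \<V> where
    "\<forall>n. finite (\<V> n) \<and> \<V> n \<subseteq> \<U> (length (map \<V> [0..<n]))" "(\<Union>n. \<V> n) \<in> \<B>"
    using assms[unfolded Alice_wins_G_fin_def not_ex, rule_format, of "\<lambda>s. \<U> (length s)"] by blast
  then show "\<exists>\<V>. (\<forall>n. finite (\<V> n) \<and> \<V> n \<subseteq> \<U> n) \<and> (\<Union>n. \<V> n) \<in> \<B>"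
    by auto
qed

section \<open>Hurewicz's theorem on the Menger game\<close>

lemma exists_play:
  fixes c :: "'b list \<Rightarrow> 'b"
  shows "\<exists>f. \<forall>n. f n = c (map f [0..<n])"
proof -
  \<comment> \<open>\<open>g n\<close> is the history of the first \<open>n\<close> moves; carrying
    it along turns recursion on the whole past into primitive recursion.\<close>
  define g where "g = rec_nat [] (\<lambda>_ h. h @ [c h])"
  have "map (\<lambda>n. c (g n)) [0..<n] = g n" for n
    by (induction n) (auto simp: g_def)
  then show ?thesis
    by (intro exI[of _ "\<lambda>n. c (g n)"]) simp
qed

text \<open>The points covered by the moves \<open>t\<close> when play starts at the position \<open>s\<close>.\<close>

primrec covered_along :: "('b list \<Rightarrow> 'b \<Rightarrow> 'z set) \<Rightarrow> 'b list \<Rightarrow> 'b list \<Rightarrow> 'z set" where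
  "covered_along U s [] = {}"
| "covered_along U s (k # t) = U s k \<union> covered_along U (s @ [k]) t"

lemma covered_along_play:
  assumes "x \<in> covered_along U (map f [0..<m]) (map f [m..<m + n])"
  shows "\<exists>j\<ge>m. x \<in> U (map f [0..<j]) (f j)"
  using assms
proof (induction n arbitrary: m)
  case (Suc n)
  have "map f [m..<m + Suc n] = f m # map f [Suc m..<Suc m + n]"
    by (simp add: upt_rec)
  with Suc.prems consider "x \<in> U (map f [0..<m]) (f m)"
    | "x \<in> covered_along U (map f [0..<Suc m]) (map f [Suc m..<Suc m + n])"
    by auto
  then show ?case
  proof cases
    case 2
    then show ?thesis
      using Suc.IH[of "Suc m"] Suc_leD by blast
  qed blast
qed simp

text \<open>\<open>U s\<close> enumerates Alice's cover at the position \<open>s\<close>. If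
  \<open>x\<close> lies in \<open>U s k0\<close>, then by monotonicity every first move from
  \<open>k0\<close> on covers \<open>U s k0\<close> at once. Only the finitely many smaller first
  moves remain, each handled by the neighbourhood that the induction hypothesis gives at the next
  position.\<close>

lemma cofinite_neighbourhood:
  fixes U :: "nat list \<Rightarrow> nat \<Rightarrow> 'z set"
  assumes cov: "\<And>s. range (U s) \<in> open_covers T" and mono: "\<And>s. mono (U s)"
    and x: "x \<in> topspace T"
  shows "\<exists>G. openin T G \<and> x \<in> G \<and> finite {t. length t = n \<and> \<not> G \<subseteq> covered_along U s t}"
proof (induction n arbitrary: s)
  case 0
  have "finite {t. length t = 0 \<and> \<not> topspace T \<subseteq> covered_along U s t}"
    by (rule finite_subset[of _ "{[]}"]) auto
  then show ?case
    using x by blast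
next
  case (Suc n)
  then have "\<forall>k. \<exists>G. openin T G \<and> x \<in> G \<and>
      finite {t. length t = n \<and> \<not> G \<subseteq> covered_along U (s @ [k]) t}"
    by blast
  then obtain G where G: "\<And>k. openin T (G k)" "\<And>k. x \<in> G k"
    "\<And>k. finite {t. length t = n \<and> \<not> G k \<subseteq> covered_along U (s @ [k]) t}"
    unfolding choice_iff by blast
  obtain k0 where k0: "x \<in> U s k0"
    using cov[of s] x unfolding open_covers_def by blast
  define H where "H = U s k0 \<inter> \<Inter>(G ` {..<k0})"
  \<comment> \<open>For \<open>k0 = 0\<close> the second factor of \<open>H\<close> is an empty
    intersection, that is \<open>UNIV\<close>, so openness is proved separately.\<close>
  have "openin T H"
  proof (cases "k0 = 0")
    case True
    then show ?thesis
      using cov[of s] by (simp add: H_def open_covers_def)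
  next
    case False
    then have "openin T (\<Inter>(G ` {..<k0}))"
      using G(1) by (intro openin_Inter) auto
    then show ?thesis
      using cov[of s] by (auto simp: H_def open_covers_def)
  qed
  moreover have "x \<in> H"
    using k0 G(2) by (simp add: H_def)
  moreover have "finite {t. length t = Suc n \<and> \<not> H \<subseteq> covered_along U s t}"
  proof (rule finite_subset)
    show "{t. length t = Suc n \<and> \<not> H \<subseteq> covered_along U s t} \<subseteq>
      (\<Union>k<k0. (#) k ` {t. length t = n \<and> \<not> G k \<subseteq> covered_along U (s @ [k]) t})"
    proof
      fix t assume t: "t \<in> {t. length t = Suc n \<and> \<not> H \<subseteq> covered_along U s t}"
      then obtain k t' where t': "t = k # t'" "length t' = n"
        by (auto simp: length_Suc_conv)
      with t have no: "\<not> H \<subseteq> U s k" "\<not> H \<subseteq> covered_along U (s @ [k]) t'"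
        by auto
      have "k < k0"
      proof (rule ccontr)
        assume "\<not> k < k0"
        then have "U s k0 \<subseteq> U s k"
          using mono[of s] by (simp add: monoD)
        then show False
          using no(1) by (auto simp: H_def)
      qed
      moreover from this have "\<not> G k \<subseteq> covered_along U (s @ [k]) t'"
        using no(2) by (auto simp: H_def)
      ultimately show "t \<in> (\<Union>k<k0. (#) k ` {t. length t = n \<and> \<not> G k \<subseteq> covered_along U (s @ [k]) t})"
        using t' by auto
    qed
    show "finite (\<Union>k<k0. (#) k ` {t. length t = n \<and> \<not> G k \<subseteq> covered_along U (s @ [k]) t})"
      using G(3) by auto
  qed
  ultimately show ?case
    by blast
qed

text \<open>For each \<open>n\<close>, the open sets that are missed by only finitely many
  continuations of length \<open>Suc n\<close> form an open cover, by
  \<open>cofinite_neighbourhood\<close>. The Menger property picks finitely many of them, and the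
  union of their exceptional sets is still finite.\<close>

lemma Menger_forbidden_choices:
  fixes U :: "nat list \<Rightarrow> nat \<Rightarrow> 'z set"
  assumes menger: "S_fin (open_covers T) (open_covers T)"
    and cov: "\<And>s. range (U s) \<in> open_covers T" and mono: "\<And>s. mono (U s)"
  shows "\<exists>B. (\<forall>n. finite (B n)) \<and>
    (\<forall>x\<in>topspace T. \<exists>n. \<forall>t. length t = Suc n \<and> t \<notin> B n \<longrightarrow> x \<in> covered_along U s t)"
proof -
  \<comment> \<open>The length is \<open>Suc n\<close> because the empty continuation covers nothing
    and could not be avoided.\<close>
  define bad where "bad n G = {t. length t = Suc n \<and> \<not> G \<subseteq> covered_along U s t}" for n G
  have "{G. openin T G \<and> finite (bad n G)} \<in> open_covers T" for n
  proof (rule open_coversI)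
    fix x assume "x \<in> topspace T"
    from cofinite_neighbourhood[of U T x "Suc n" s, OF cov mono this]
    show "\<exists>G\<in>{G. openin T G \<and> finite (bad n G)}. x \<in> G"
      unfolding bad_def by blast
  qed simp
  then obtain \<G> where \<G>: "\<And>n. finite (\<G> n)" "\<And>n. \<G> n \<subseteq> {G. openin T G \<and> finite (bad n G)}"
    "(\<Union>n. \<G> n) \<in> open_covers T"
    using menger[unfolded S_fin_def, rule_format, of "\<lambda>n. {G. openin T G \<and> finite (bad n G)}"]
    by blast
  define B where "B n = (\<Union>G\<in>\<G> n. bad n G)" for n
  have "finite (B n)" for n
    unfolding B_def by (rule finite_UN_I[OF \<G>(1)]) (use \<G>(2)[of n] in blast)
  moreover have "\<exists>n. \<forall>t. length t = Suc n \<and> t \<notin> B n \<longrightarrow> x \<in> covered_along U s t"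
    if "x \<in> topspace T" for x
  proof -
    have "x \<in> \<Union>(\<Union>n. \<G> n)"
      using \<G>(3) that by (simp add: open_covers_def)
    then obtain n G where "G \<in> \<G> n" "x \<in> G"
      by blast
    then show ?thesis
      unfolding B_def bad_def by (intro exI[of _ n]) auto
  qed
  ultimately show ?thesis
    by (intro exI[of _ B]) simp
qed

text \<open>Points are covered again after every inning \<open>m\<close> because each position of
  the play serves as a starting position with its own forbidden continuations. Pawlikowski's theorem
  relies on these repeated visits.\<close>

theorem Hurewicz_tree:
  fixes U :: "nat list \<Rightarrow> nat \<Rightarrow> 'z set"
  assumes "S_fin (open_covers T) (open_covers T)"
    and "\<And>s. range (U s) \<in> open_covers T" and "\<And>s. mono (U s)"
  shows "\<exists>f. \<forall>x\<in>topspace T. \<forall>m. \<exists>n\<ge>m. x \<in> U (map f [0..<n]) (f n)"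
proof -
  obtain B where fin: "\<And>s n. finite (B s n)" and
    B: "\<And>s x. x \<in> topspace T \<Longrightarrow>
      \<exists>n. \<forall>t. length t = Suc n \<and> t \<notin> B s n \<longrightarrow> x \<in> covered_along U s t"
    using Menger_forbidden_choices[of T U, OF assms] by metis
  \<comment> \<open>A move \<open>k\<close> after the history \<open>h\<close> completes one block
    of moves for each starting position \<open>take m h\<close>. Each position forbids finitely many
    blocks, and a block determines its last move, so only finitely many \<open>k\<close> are
    excluded.\<close>
  have "\<exists>k. \<forall>m\<le>length h. drop m h @ [k] \<notin> B (take m h) (length h - m)" for h
  proof -
    have "finite (\<Union>m\<le>length h. (\<lambda>k. drop m h @ [k]) -` B (take m h) (length h - m))"
      using fin by (auto intro!: finite_vimageI injI)
    then obtain k where "k \<notin> (\<Union>m\<le>length h. (\<lambda>k. drop m h @ [k]) -` B (take m h) (length h - m))"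
      using ex_new_if_finite[OF infinite_UNIV_nat] by blast
    then show ?thesis
      by auto
  qed
  then obtain c where
    c: "\<And>h m. m \<le> length h \<Longrightarrow> drop m h @ [c h] \<notin> B (take m h) (length h - m)"
    by metis
  obtain f where f: "\<And>n. f n = c (map f [0..<n])"
    using exists_play by blast
  have avoid: "map f [m..<m + Suc n] \<notin> B (map f [0..<m]) n" for m n
    using c[of m "map f [0..<m + n]"] by (simp add: f[symmetric] drop_map take_map)
  show ?thesis
  proof (rule exI[of _ f], intro ballI allI)
    fix x m assume "x \<in> topspace T"
    then obtain n where
      "\<forall>t. length t = Suc n \<and> t \<notin> B (map f [0..<m]) n \<longrightarrow> x \<in> covered_along U (map f [0..<m]) t"
      using B by blast
    then have "x \<in> covered_along U (map f [0..<m]) (map f [m..<m + Suc n])"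
      using avoid[of m n] by (metis add_diff_cancel_left' length_map length_upt)
    then show "\<exists>n\<ge>m. x \<in> U (map f [0..<n]) (f n)"
      by (rule covered_along_play)
  qed
qed

section \<open>Pawlikowski's theorem on the Rothberger game\<close>

lemma injective_choice:
  fixes I :: "nat \<Rightarrow> 'b set"
  assumes "\<And>m. card (I m) = Suc m"
  shows "\<exists>p. inj p \<and> (\<forall>m. p m \<in> I m)"
proof -
  have "\<exists>i. i \<in> I (length h) - set h" for h :: "'b list"
  proof -
    \<comment> \<open>The history \<open>h\<close> uses at most \<open>length h\<close> values, and
      the next set has one element more.\<close>
    have "card (set h) < card (I (length h))"
      using assms card_length[of h] by (simp add: le_imp_less_Suc)
    then show ?thesis
      using card_mono[of "set h" "I (length h)"] by fastforce
  qed
  then obtain c where c: "\<And>h. c h \<in> I (length h) - set h"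
    by metis
  obtain p where p: "\<And>n. p n = c (map p [0..<n])"
    using exists_play by blast
  have p': "p n \<in> I n - p ` {0..<n}" for n
    using c[of "map p [0..<n]"] by (simp add: p[symmetric])
  have "inj p"
    by (rule linorder_injI) (metis DiffE atLeast0LessThan imageI lessThan_iff p')
  then show ?thesis
    using p' by blast
qed

text \<open>
  Apply the Rothberger property to the intersections of members of \<open>m + 1\<close> different families. The
  \<open>m\<close>-th selected intersection may then be assigned to one of its families that has not been used
  before.
\<close>

lemma Rothberger_infinitely_often:
  assumes roth: "S_1 (open_covers T) (open_covers T)"
    and op: "\<And>n V. V \<in> \<F> n \<Longrightarrow> openin T V" and ne: "\<And>n. \<F> n \<noteq> {}"
    and io: "\<And>x m. x \<in> topspace T \<Longrightarrow> \<exists>n\<ge>m. x \<in> \<Union>(\<F> n)"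
  shows "\<exists>V. (\<forall>n :: nat. V n \<in> \<F> n) \<and> topspace T \<subseteq> (\<Union>n. V n)"
proof -
  define \<W> where
    "\<W> m = {W. \<exists>I v. card I = Suc m \<and> (\<forall>i\<in>I. v i \<in> \<F> i) \<and> W = \<Inter>(v ` I)}" for m
  have "\<W> m \<in> open_covers T" for m
  proof (rule open_coversI)
    fix W assume "W \<in> \<W> m"
    then obtain I v where W: "card I = Suc m" "\<forall>i\<in>I. v i \<in> \<F> i" "W = \<Inter>(v ` I)"
      unfolding \<W>_def by blast
    then have "finite I" "I \<noteq> {}"
      by (auto intro: card_ge_0_finite)
    then show "openin T W"
      using W op by (auto intro!: openin_Inter)
  next
    fix x assume x: "x \<in> topspace T"
    have "infinite {n. x \<in> \<Union>(\<F> n)}"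
      unfolding infinite_nat_iff_unbounded_le using io[OF x] by auto
    then obtain I where I: "card I = Suc m" "I \<subseteq> {n. x \<in> \<Union>(\<F> n)}"
      using infinite_arbitrarily_large by blast
    then have "\<forall>i\<in>I. \<exists>V. V \<in> \<F> i \<and> x \<in> V"
      by blast
    then obtain v where "\<forall>i\<in>I. v i \<in> \<F> i \<and> x \<in> v i"
      by metis
    with I(1) show "\<exists>W\<in>\<W> m. x \<in> W"
      unfolding \<W>_def by blast
  qed
  then obtain W where W: "\<And>m. W m \<in> \<W> m" "range W \<in> open_covers T"
    using roth unfolding S_1_def by metis
  then have "\<forall>m. \<exists>I v. card I = Suc m \<and> (\<forall>i\<in>I. v i \<in> \<F> i) \<and> W m = \<Inter>(v ` I)"
    unfolding \<W>_def by blast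
  then obtain I v where Iv: "\<And>m. card (I m) = Suc m" "\<And>m i. i \<in> I m \<Longrightarrow> v m i \<in> \<F> i"
    "\<And>m. W m = \<Inter>(v m ` I m)"
    by metis
  obtain p where p: "inj p" "\<And>m. p m \<in> I m"
    using injective_choice[OF Iv(1)] by blast
  \<comment> \<open>\<open>inv p n\<close> recovers the \<open>m\<close> with
    \<open>p m = n\<close>, so \<open>V (p m)\<close> is one of the sets intersected in
    \<open>W m\<close>. Indices outside the range of \<open>p\<close> get an arbitrary
    member.\<close>
  define V where "V n = (if n \<in> range p then v (inv p n) n else SOME V. V \<in> \<F> n)" for n
  have "V n \<in> \<F> n" for n
    using Iv(2) p ne by (auto simp: V_def some_in_eq)
  moreover have "W m \<subseteq> V (p m)" for m
    using p Iv(3)[of m] by (auto simp: V_def)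
  then have "topspace T \<subseteq> (\<Union>n. V n)"
    using W(2) unfolding open_covers_def by blast
  ultimately show ?thesis
    by blast
qed

text \<open>Bounds \<open>ks\<close> on the choices so far leave only finitely many positions, which
  keeps the intersections over positions in the next theorem open.\<close>

lemma finite_lists_below: "finite {s :: nat list. list_all2 (\<le>) s ks}"
proof (induction ks)
  case (Cons k ks)
  have "{s. list_all2 (\<le>) s (k # ks)} = (\<lambda>(j, s). j # s) ` ({..k} \<times> {s. list_all2 (\<le>) s ks})"
    by (auto simp: list_all2_Cons2)
  then show ?case
    using Cons by simp
qed simp

text \<open>Bob's moves are fixed in two stages: the Menger game yields bounds \<open>g\<close>, and
  the Rothberger property then yields moves below them. An answer is prepared for every position
  within the bounds before it is known which one occurs.\<close>

theorem Pawlikowski_tree: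
  fixes U :: "nat list \<Rightarrow> nat \<Rightarrow> 'z set"
  assumes roth: "S_1 (open_covers T) (open_covers T)"
    and cov: "\<And>s. range (U s) \<in> open_covers T"
  shows "\<exists>f. topspace T \<subseteq> (\<Union>n. U (map f [0..<n]) (f n))"
proof -
  define P where "P ks = {s :: nat list. list_all2 (\<le>) s ks}" for ks
  have finP: "finite (P ks)" for ks
    unfolding P_def by (rule finite_lists_below)
  have openU: "openin T (U s k)" for s k
    using cov[of s] by (auto simp: open_covers_def)
  have openI: "openin T (topspace T \<inter> \<Inter>(A ` P ks))" if "\<And>s. openin T (A s)" for A ks
    using that finP[of ks] by (cases "P ks = {}") (auto intro!: openin_Int openin_Inter)
  \<comment> \<open>A move \<open>k\<close> in the auxiliary Menger game is a bound: a point counts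
    as covered if at every position within the earlier bounds \<open>ks\<close> some move up to
    \<open>k\<close> covers it.\<close>
  define M where "M ks k = topspace T \<inter> (\<Inter>s\<in>P ks. \<Union>j\<le>k. U s j)" for ks k
  have "range (M ks) \<in> open_covers T" for ks
  proof (rule open_coversI)
    fix V assume "V \<in> range (M ks)"
    then show "openin T V"
      using openU by (auto simp: M_def intro!: openI openin_Union)
  next
    fix x assume x: "x \<in> topspace T"
    then have "\<exists>j. x \<in> U s j" for s
      using cov[of s] unfolding open_covers_def by blast
    then obtain j where j: "\<And>s. x \<in> U s (j s)"
      by metis
    \<comment> \<open>Finitely many positions admit a common bound for the indices that cover
      \<open>x\<close>.\<close>
    have "x \<in> M ks (Max (j ` P ks))"
      using x j finP[of ks] by (auto simp: M_def intro!: bexI[of _ "j _"])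
    then show "\<exists>V\<in>range (M ks). x \<in> V"
      by blast
  qed
  moreover have "mono (M ks)" for ks
    by (rule monoI) (fastforce simp: M_def)
  ultimately obtain g where
    g: "\<And>x m. x \<in> topspace T \<Longrightarrow> \<exists>n\<ge>m. x \<in> M (map g [0..<n]) (g n)"
    using Hurewicz_tree[OF S_1_imp_S_fin[OF roth], of M] by blast
  define Q where "Q n = P (map g [0..<n])" for n
  \<comment> \<open>Each member of \<open>\<F> n\<close> comes with one answer \<open>j s\<close>
    per position \<open>s\<close>, and lies in the set so chosen at every position in
    \<open>Q n\<close>.\<close>
  define \<F> where
    "\<F> n = {V. \<exists>j. (\<forall>s. j s \<le> g n) \<and> V = topspace T \<inter> (\<Inter>s\<in>Q n. U s (j s))}" for n
  have "\<exists>V. (\<forall>n. V n \<in> \<F> n) \<and> topspace T \<subseteq> (\<Union>n. V n)"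
  proof (rule Rothberger_infinitely_often[OF roth])
    show "openin T V" if "V \<in> \<F> n" for n V
      using that openU by (auto simp: \<F>_def Q_def intro!: openI)
    show "\<F> n \<noteq> {}" for n
      unfolding \<F>_def by (auto intro!: exI[of _ "\<lambda>_. 0"])
    fix x m assume x: "x \<in> topspace T"
    then obtain n where n: "n \<ge> m" "x \<in> M (map g [0..<n]) (g n)"
      using g by blast
    then have "\<forall>s. \<exists>j\<le>g n. s \<in> Q n \<longrightarrow> x \<in> U s j"
      unfolding M_def Q_def by blast
    then obtain j where "\<And>s. j s \<le> g n" "\<And>s. s \<in> Q n \<Longrightarrow> x \<in> U s (j s)"
      by metis
    with x have "x \<in> \<Union>(\<F> n)"
      unfolding \<F>_def by blast
    with n(1) show "\<exists>n\<ge>m. x \<in> \<Union>(\<F> n)"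
      by blast
  qed
  then obtain V where V: "\<And>n. V n \<in> \<F> n" "topspace T \<subseteq> (\<Union>n. V n)"
    by blast
  from V(1) have "\<forall>n. \<exists>j. (\<forall>s. j s \<le> g n) \<and> V n = topspace T \<inter> (\<Inter>s\<in>Q n. U s (j s))"
    unfolding \<F>_def by blast
  then obtain j where j: "\<And>n s. j n s \<le> g n"
    "\<And>n. V n = topspace T \<inter> (\<Inter>s\<in>Q n. U s (j n s))"
    by metis
  \<comment> \<open>Follow the prepared answers from the position actually reached; its length is
    the inning.\<close>
  obtain f where f: "\<And>n. f n = j (length (map f [0..<n])) (map f [0..<n])"
    using exists_play[of "\<lambda>s. j (length s) s"] by blast
  then have f: "f n = j n (map f [0..<n])" for n
    by (metis diff_zero length_map length_upt)
  \<comment> \<open>Moves below \<open>g\<close> keep the play inside the positions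
    \<open>Q n\<close> for which \<open>V n\<close> was built.\<close>
  have "f n \<le> g n" for n
    using f[of n] j(1) by simp
  then have "map f [0..<n] \<in> Q n" for n
    by (simp add: Q_def P_def list_all2_conv_all_nth)
  then have "V n \<subseteq> U (map f [0..<n]) (f n)" for n
    using j(2)[of n] f[of n] by auto
  then have "(\<Union>n. V n) \<subseteq> (\<Union>n. U (map f [0..<n]) (f n))"
    by (intro UN_mono order_refl)
  with V(2) show ?thesis
    by (metis order_trans)
qed

section \<open>The space of convergent filters\<close>

definition convergent_filters :: "'a set \<Rightarrow> ('a filter \<Rightarrow> 'a set) \<Rightarrow> 'a filter set" where
  "convergent_filters X L = {F \<in> Fil X. L F \<noteq> {}}"

definition hat :: "'a set \<Rightarrow> ('a filter \<Rightarrow> 'a set) \<Rightarrow> 'a set \<Rightarrow> 'a filter set" where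
  "hat X L A = {F \<in> convergent_filters X L. A \<in> members X F}"

definition filter_topology :: "'a set \<Rightarrow> ('a filter \<Rightarrow> 'a set) \<Rightarrow> 'a filter topology" where
  "filter_topology X L = topology (\<lambda>\<O>. \<O> \<subseteq> convergent_filters X L \<and>
     (\<forall>F\<in>\<O>. \<exists>A\<subseteq>X. F \<in> hat X L A \<and> hat X L A \<subseteq> \<O>))"

lemma hat_Int:
  assumes "A \<subseteq> X" "B \<subseteq> X"
  shows "hat X L (A \<inter> B) = hat X L A \<inter> hat X L B"
proof -
  have "A \<inter> B \<in> members X F \<longleftrightarrow> A \<in> members X F \<and> B \<in> members X F" for F
    using assms by (simp add: members_def eventually_conj_iff le_infI1)
  then show ?thesis
    unfolding hat_def by blast
qed

lemma hat_carrier: "hat X L X = convergent_filters X L"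
  by (simp add: hat_def convergent_filters_def members_def Fil_def le_principal cong: conj_cong)

text \<open>By \<open>hat_Int\<close> the basic sets are closed under binary intersections, which
  makes intersections of two open sets open.\<close>

lemma openin_filter_topology:
  "openin (filter_topology X L) \<O> \<longleftrightarrow> \<O> \<subseteq> convergent_filters X L \<and>
     (\<forall>F\<in>\<O>. \<exists>A\<subseteq>X. F \<in> hat X L A \<and> hat X L A \<subseteq> \<O>)"
proof -
  have "istopology (\<lambda>\<O>. \<O> \<subseteq> convergent_filters X L \<and>
     (\<forall>F\<in>\<O>. \<exists>A\<subseteq>X. F \<in> hat X L A \<and> hat X L A \<subseteq> \<O>))" (is "istopology ?open")
    unfolding istopology_def
  proof (rule conjI; intro allI impI)
    fix S S' assume S: "?open S" and S': "?open S'"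
    show "?open (S \<inter> S')"
    proof (intro conjI ballI)
      show "S \<inter> S' \<subseteq> convergent_filters X L"
        using S by blast
      fix F assume "F \<in> S \<inter> S'"
      then obtain A B where "A \<subseteq> X" "F \<in> hat X L A" "hat X L A \<subseteq> S"
        and "B \<subseteq> X" "F \<in> hat X L B" "hat X L B \<subseteq> S'"
        using S S' by (meson IntD1 IntD2)
      then show "\<exists>C\<subseteq>X. F \<in> hat X L C \<and> hat X L C \<subseteq> S \<inter> S'"
        using hat_Int[of A X B L] by (intro exI[of _ "A \<inter> B"]) blast
    qed
  next
    fix \<K> assume \<K>: "\<forall>K\<in>\<K>. ?open K"
    show "?open (\<Union>\<K>)"
    proof (intro conjI ballI)
      show "\<Union>\<K> \<subseteq> convergent_filters X L"
        using \<K> by blast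
      fix F assume "F \<in> \<Union>\<K>"
      then obtain K where K: "K \<in> \<K>" "F \<in> K"
        by blast
      with \<K> obtain A where "A \<subseteq> X" "F \<in> hat X L A" "hat X L A \<subseteq> K"
        by meson
      with K(1) show "\<exists>A\<subseteq>X. F \<in> hat X L A \<and> hat X L A \<subseteq> \<Union>\<K>"
        by (meson Union_upper order_trans)
    qed
  qed
  then show ?thesis
    by (simp add: filter_topology_def)
qed

lemma topspace_filter_topology: "topspace (filter_topology X L) = convergent_filters X L"
proof (rule antisym)
  show "topspace (filter_topology X L) \<subseteq> convergent_filters X L"
    using openin_topspace openin_filter_topology by blast
  have "openin (filter_topology X L) (convergent_filters X L)"
    using hat_carrier by (fastforce simp: openin_filter_topology)
  then show "convergent_filters X L \<subseteq> topspace (filter_topology X L)"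
    by (rule openin_subset)
qed

lemma openin_hat:
  assumes "A \<subseteq> X"
  shows "openin (filter_topology X L) (hat X L A)"
proof -
  have "hat X L A \<subseteq> convergent_filters X L"
    by (auto simp: hat_def)
  with assms show ?thesis
    unfolding openin_filter_topology by blast
qed

section \<open>Transfer of selection principles between \<open>L\<close>-covers and open
  covers\<close>

lemma mem_covers_iff:
  "\<U> \<in> covers X L \<longleftrightarrow> \<U> \<subseteq> Pow X \<and> convergent_filters X L \<subseteq> (\<Union>A\<in>\<U>. hat X L A)"
proof -
  have "\<U> \<inter> members X F \<noteq> {} \<longleftrightarrow> F \<in> (\<Union>A\<in>\<U>. hat X L A)"
    if "F \<in> Fil X" "L F \<noteq> {}" for F
    using that by (auto simp: hat_def convergent_filters_def)
  then show ?thesis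
    by (auto simp: covers_def convergent_filters_def simp del: UN_iff)
qed

text \<open>Open covers may contain sets that are not basic. This lemma refines them by basic sets,
  the selection is made there, and \<open>open_covers_coarser\<close> allows the selected sets to be
  enlarged to members of the original covers.\<close>

lemma covers_refining:
  assumes "\<V> \<in> open_covers (filter_topology X L)"
  shows "{A. A \<subseteq> X \<and> (\<exists>V\<in>\<V>. hat X L A \<subseteq> V)} \<in> covers X L"
proof -
  have "\<exists>A\<in>{A. A \<subseteq> X \<and> (\<exists>V\<in>\<V>. hat X L A \<subseteq> V)}. F \<in> hat X L A"
    if "F \<in> convergent_filters X L" for F
  proof -
    have "F \<in> \<Union>\<V>"
      using assms that by (simp add: open_covers_def topspace_filter_topology)
    then obtain V where V: "V \<in> \<V>" "F \<in> V"
      by blast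
    then have "openin (filter_topology X L) V"
      using assms by (simp add: open_covers_def)
    with V show ?thesis
      unfolding openin_filter_topology by blast
  qed
  then show ?thesis
    by (auto simp: mem_covers_iff)
qed

lemma open_covers_coarser:
  assumes "\<U> \<in> covers X L" "\<And>V. V \<in> \<V> \<Longrightarrow> openin (filter_topology X L) V"
    and "\<And>A. A \<in> \<U> \<Longrightarrow> \<exists>V\<in>\<V>. hat X L A \<subseteq> V"
  shows "\<V> \<in> open_covers (filter_topology X L)"
proof (rule open_coversI)
  fix F assume "F \<in> topspace (filter_topology X L)"
  then obtain A where "A \<in> \<U>" "F \<in> hat X L A"
    using assms(1) by (auto simp: mem_covers_iff topspace_filter_topology)
  then show "\<exists>V\<in>\<V>. F \<in> V"
    using assms(3) by blast
qed (rule assms(2))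

lemma S_1_filter_topology:
  assumes "S_1 (covers X L) (covers X L)"
  shows "S_1 (open_covers (filter_topology X L)) (open_covers (filter_topology X L))"
  unfolding S_1_def
proof (intro allI impI)
  fix \<V> :: "nat \<Rightarrow> 'a filter set set"
  assume \<V>: "\<forall>n. \<V> n \<in> open_covers (filter_topology X L)"
  define \<U> where "\<U> n = {A. A \<subseteq> X \<and> (\<exists>V\<in>\<V> n. hat X L A \<subseteq> V)}" for n
  have "\<forall>n. \<U> n \<in> covers X L"
    using \<V> by (simp add: \<U>_def covers_refining)
  then have "\<exists>A. (\<forall>n. A n \<in> \<U> n) \<and> range A \<in> covers X L"
    by (rule assms[unfolded S_1_def, THEN spec, THEN mp])
  then obtain A where A: "\<And>n. A n \<in> \<U> n" "range A \<in> covers X L"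
    by blast
  have "\<exists>V. V \<in> \<V> n \<and> hat X L (A n) \<subseteq> V" for n
    using A(1)[of n] by (auto simp: \<U>_def)
  then obtain V where V: "\<And>n. V n \<in> \<V> n" "\<And>n. hat X L (A n) \<subseteq> V n"
    by metis
  have "range V \<in> open_covers (filter_topology X L)"
  proof (rule open_covers_coarser[OF A(2)])
    show "openin (filter_topology X L) W" if "W \<in> range V" for W
      using that V(1) \<V> openin_open_covers by blast
    show "\<exists>W\<in>range V. hat X L B \<subseteq> W" if "B \<in> range A" for B
      using that V(2) by blast
  qed
  with V(1) show "\<exists>V. (\<forall>n. V n \<in> \<V> n) \<and> range V \<in> open_covers (filter_topology X L)"
    by blast
qed

lemma S_fin_filter_topology:
  assumes "S_fin (covers X L) (covers X L)"
  shows "S_fin (open_covers (filter_topology X L)) (open_covers (filter_topology X L))"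
  unfolding S_fin_def
proof (intro allI impI)
  fix \<V> :: "nat \<Rightarrow> 'a filter set set"
  assume \<V>: "\<forall>n. \<V> n \<in> open_covers (filter_topology X L)"
  define \<U> where "\<U> n = {A. A \<subseteq> X \<and> (\<exists>V\<in>\<V> n. hat X L A \<subseteq> V)}" for n
  have "\<forall>n. \<U> n \<in> covers X L"
    using \<V> by (simp add: \<U>_def covers_refining)
  then have "\<exists>\<A>. (\<forall>n. finite (\<A> n) \<and> \<A> n \<subseteq> \<U> n) \<and> (\<Union>n. \<A> n) \<in> covers X L"
    by (rule assms[unfolded S_fin_def, THEN spec, THEN mp])
  then obtain \<A> where \<A>: "\<And>n. finite (\<A> n)" "\<And>n. \<A> n \<subseteq> \<U> n"
    "(\<Union>n. \<A> n) \<in> covers X L"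
    by blast
  have "\<forall>n A. \<exists>V. A \<in> \<A> n \<longrightarrow> V \<in> \<V> n \<and> hat X L A \<subseteq> V"
    using \<A>(2) unfolding \<U>_def by blast
  then obtain V where V: "\<And>n A. A \<in> \<A> n \<Longrightarrow> V n A \<in> \<V> n \<and> hat X L A \<subseteq> V n A"
    unfolding choice_iff by blast
  have "(\<Union>n. V n ` \<A> n) \<in> open_covers (filter_topology X L)"
  proof (rule open_covers_coarser[OF \<A>(3)])
    show "openin (filter_topology X L) W" if "W \<in> (\<Union>n. V n ` \<A> n)" for W
      using that V \<V> openin_open_covers by blast
    show "\<exists>W\<in>\<Union>n. V n ` \<A> n. hat X L B \<subseteq> W" if "B \<in> (\<Union>n. \<A> n)" for B
      using that V by blast
  qed
  then show "\<exists>\<W>. (\<forall>n. finite (\<W> n) \<and> \<W> n \<subseteq> \<V> n) \<and>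
      (\<Union>n. \<W> n) \<in> open_covers (filter_topology X L)"
    using V \<A>(1) by (intro exI[of _ "\<lambda>n. V n ` \<A> n"]) blast
qed

section \<open>Defeating Alice's strategies on \<open>L\<close>-covers\<close>

definition choices :: "('c list \<Rightarrow> nat \<Rightarrow> 'c) \<Rightarrow> nat list \<Rightarrow> 'c list" where
  "choices e = foldl (\<lambda>h k. h @ [e h k]) []"

text \<open>The tree theorems record Bob's moves as indices, whereas strategies read the sets
  themselves. Here \<open>e h\<close> enumerates candidate moves after the history \<open>h\<close>,
  and the translated histories turn out to be initial segments of a single play.\<close>

lemma choices_play:
  "choices e (map f [0..<n]) = map (\<lambda>n. e (choices e (map f [0..<n])) (f n)) [0..<n]"
  by (induction n) (auto simp: choices_def)

lemma not_Alice_wins_G_1: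
  assumes S1: "S_1 (covers X L) (covers X L)"
  shows "\<not> Alice_wins_G_1 (covers X L) (covers X L)"
  unfolding Alice_wins_G_1_def
proof (safe, goal_cases)
  case (1 \<sigma>)
  \<comment> \<open>Alice's family may be uncountable; \<open>S_1\<close> applied to the constant
    sequence extracts an enumerated subcover.\<close>
  have "\<forall>s. \<exists>e. (\<forall>n :: nat. e n \<in> \<sigma> s) \<and> range e \<in> covers X L"
    using S1[unfolded S_1_def, rule_format, of "\<lambda>_. \<sigma> _"] 1(1) by blast
  then obtain e where e: "\<And>s (n :: nat). e s n \<in> \<sigma> s" "\<And>s. range (e s) \<in> covers X L"
    unfolding choice_iff by blast
  have sub: "e s n \<subseteq> X" for s n
    using e(2)[of s] by (auto simp: mem_covers_iff)
  have "\<exists>f. topspace (filter_topology X L) \<subseteq>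
      (\<Union>n. hat X L (e (choices e (map f [0..<n])) (f n)))"
  proof (rule Pawlikowski_tree[OF S_1_filter_topology[OF S1]])
    show "range (\<lambda>k. hat X L (e (choices e s) k)) \<in> open_covers (filter_topology X L)" for s
      by (rule open_covers_coarser[OF e(2)[of "choices e s"]]) (use openin_hat[OF sub] in auto)
  qed
  then obtain f where f: "topspace (filter_topology X L) \<subseteq>
      (\<Union>n. hat X L (e (choices e (map f [0..<n])) (f n)))"
    by blast
  define U where "U n = e (choices e (map f [0..<n])) (f n)" for n
  have "choices e (map f [0..<n]) = map U [0..<n]" for n
    unfolding U_def by (rule choices_play)
  then have "U n \<in> \<sigma> (map U [0..<n])" for n
    using e(1)[of "choices e (map f [0..<n])" "f n"] by (simp add: U_def)
  moreover have "range U \<in> covers X L"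
    using f sub by (auto simp: mem_covers_iff topspace_filter_topology U_def)
  ultimately show False
    using 1(2) by blast
qed

lemma not_Alice_wins_G_fin:
  assumes Sfin: "S_fin (covers X L) (covers X L)"
  shows "\<not> Alice_wins_G_fin (covers X L) (covers X L)"
  unfolding Alice_wins_G_fin_def
proof (safe, goal_cases)
  case (1 \<sigma>)
  \<comment> \<open>Again a constant sequence, now giving a countable subcover cut into finite
    pieces.\<close>
  have "\<forall>s. \<exists>e. (\<forall>n :: nat. finite (e n) \<and> e n \<subseteq> \<sigma> s) \<and> (\<Union>n. e n) \<in> covers X L"
    using Sfin[unfolded S_fin_def, rule_format, of "\<lambda>_. \<sigma> _"] 1(1) by blast
  then obtain e0 where e0: "\<And>s (n :: nat). finite (e0 s n)" "\<And>s n. e0 s n \<subseteq> \<sigma> s"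
    "\<And>s. (\<Union>n. e0 s n) \<in> covers X L"
    unfolding choice_iff by blast
  \<comment> \<open>Accumulating the pieces makes Bob's options increase with \<open>n\<close>, as
    \<open>Hurewicz_tree\<close> requires.\<close>
  define e where "e s n = (\<Union>i\<le>n. e0 s i)" for s n
  have e: "finite (e s n)" "e s n \<subseteq> \<sigma> s" for s n
    using e0(1) UN_least[of "{..n}" "e0 s" "\<sigma> s"] e0(2) by (simp_all add: e_def)
  have sub: "A \<subseteq> X" if "A \<in> e s n" for A s n
    using that e0(3)[of s] by (auto simp: mem_covers_iff e_def)
  define T where "T s k = (\<Union>A\<in>e (choices e s) k. hat X L A)" for s k
  have "range (T s) \<in> open_covers (filter_topology X L)" for s
  proof (rule open_covers_coarser[OF e0(3)[of "choices e s"]])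
    show "openin (filter_topology X L) V" if "V \<in> range (T s)" for V
      using that sub by (auto simp: T_def intro!: openin_Union openin_hat)
    show "\<exists>V\<in>range (T s). hat X L A \<subseteq> V" if "A \<in> (\<Union>n. e0 (choices e s) n)" for A
      using that unfolding T_def e_def by blast
  qed
  moreover have "mono (T s)" for s
    by (rule monoI) (fastforce simp: T_def e_def)
  ultimately obtain f where
    f: "\<And>F m. F \<in> topspace (filter_topology X L) \<Longrightarrow> \<exists>n\<ge>m. F \<in> T (map f [0..<n]) (f n)"
    using Hurewicz_tree[OF S_fin_filter_topology[OF Sfin], of T] by blast
  define V where "V n = e (choices e (map f [0..<n])) (f n)" for n
  have "choices e (map f [0..<n]) = map V [0..<n]" for n
    unfolding V_def by (rule choices_play)
  then have "finite (V n) \<and> V n \<subseteq> \<sigma> (map V [0..<n])" for n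
    using e[of "choices e (map f [0..<n])" "f n"] by (simp add: V_def)
  moreover have "(\<Union>n. V n) \<in> covers X L"
  proof -
    have "\<exists>A\<in>\<Union>n. V n. F \<in> hat X L A" if "F \<in> convergent_filters X L" for F
      \<comment> \<open>A single visit suffices, hence \<open>m = 0\<close>.\<close>
      using f[of F 0] that by (auto simp: topspace_filter_topology T_def V_def)
    moreover have "(\<Union>n. V n) \<subseteq> Pow X"
      using sub unfolding V_def by blast
    ultimately show ?thesis
      by (simp add: mem_covers_iff subset_iff)
  qed
  ultimately show False
    using 1(2) by blast
qed

theorem corollary3p3:
  fixes X :: "'a set" and L :: "'a filter \<Rightarrow> 'a set"
  assumes "convergence_space X L"
  shows "(S_fin (covers X L) (covers X L) \<longleftrightarrow> \<not> Alice_wins_G_fin (covers X L) (covers X L)) \<and>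
         (S_1 (covers X L) (covers X L) \<longleftrightarrow> \<not> Alice_wins_G_1 (covers X L) (covers X L))"
  using S_fin_if_not_Alice_wins not_Alice_wins_G_fin S_1_if_not_Alice_wins not_Alice_wins_G_1
  by blast

end
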